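(* Let $A$ be an additive abelian group, let $\varphi\in\operatorname{Aut}A$, and let $Q:=\operatorname{Alex}(A,\varphi)$ be the corresponding Alexander quandle, with quandle structure $s$. Then $\operatorname{Good}Q$ is nonempty if and only if $Q$ is a kei. In this case, a function $\rho:A\to A$ is a good involution of $Q$ if and only if there exists a function $\psi:A\to\operatorname{Fix}\varphi$ such that \[ \rho(a)=\psi(a)-\varphi(a),\qquad \psi\circ s_a=\psi=\psi\circ\rho \] for all $a\in A$. In particular (in this case), $|\operatorname{Good}Q|\geq|\operatorname{Fix}\varphi|$.
   Context: A quandle is a pair $(X,s)$ where $X$ is a set and $s:X\to S_X$, $x\mapsto s_x$, is a function to the symmetric group $S_X$ such that $s_xs_y=s_{s_x(y)}s_x$ and $s_x(x)=x$ for all $x,y\in X$. A quandle is a kei (or involutory) if $s_x^2=\mathrm{id}_X$ for all $x\in X$. For an additive abelian group $A$ and $\varphi\in\operatorname{Aut}A$, the Alexander quandle $\operatorname{Alex}(A,\varphi)$ is the quandle with underlying set $A$ and $s_a(b):=\varphi(b-a)+a$ for all $a,b\in A$. $\operatorname{Fix}\varphi\leq A$ is the subgroup of fixed points of $\varphi$. A good involution of a quandle $(X,s)$ is a permutation $\rho\in S_X$ with $\rho^2=\mathrm{id}_X$ (the identity map is allowed) such that $\rho s_x=s_x\rho$ and $s_{\rho(x)}=s_x^{-1}$ for all $x\in X$. $\operatorname{Good}Q$ denotes the set of all good involutions of $Q$. *)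

theory Defs
  imports Complex_Main "HOL-Library.FuncSet" "HOL-Library.Equipollence"
begin

text \<open>
  Quandles are carried by a whole type; the structure map \<open>s\<close> is curried, so \<open>s x\<close> is
  the permutation attached to \<open>x\<close>.
\<close>

definition quandle :: "('a \<Rightarrow> 'a \<Rightarrow> 'a) \<Rightarrow> bool" where
  "quandle s \<longleftrightarrow>
    (\<forall>x. bij (s x)) \<and>
    (\<forall>x y. s x \<circ> s y = s (s x y) \<circ> s x) \<and>
    (\<forall>x. s x x = x)"

definition kei :: "('a \<Rightarrow> 'a \<Rightarrow> 'a) \<Rightarrow> bool" where
  "kei s \<longleftrightarrow> quandle s \<and> (\<forall>x. s x \<circ> s x = id)"

definition good_involution :: "('a \<Rightarrow> 'a \<Rightarrow> 'a) \<Rightarrow> ('a \<Rightarrow> 'a) \<Rightarrow> bool" where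
  "good_involution s \<rho> \<longleftrightarrow>
    bij \<rho> \<and> \<rho> \<circ> \<rho> = id \<and>
    (\<forall>x. \<rho> \<circ> s x = s x \<circ> \<rho> \<and> s (\<rho> x) = inv (s x))"

definition Good :: "('a \<Rightarrow> 'a \<Rightarrow> 'a) \<Rightarrow> ('a \<Rightarrow> 'a) set" where
  "Good s = {\<rho>. good_involution s \<rho>}"

definition Aut :: "('a::ab_group_add \<Rightarrow> 'a) set" where
  "Aut = {\<phi>. bij \<phi> \<and> Modules.additive \<phi>}"

definition Fix :: "('a \<Rightarrow> 'a) \<Rightarrow> 'a set" where
  "Fix \<phi> = {a. \<phi> a = a}"

definition Alex :: "('a::ab_group_add \<Rightarrow> 'a) \<Rightarrow> 'a \<Rightarrow> 'a \<Rightarrow> 'a" where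
  "Alex \<phi> a b = \<phi> (b - a) + a"

lemma quandle_Alex:
  assumes "\<phi> \<in> Aut"
  shows "quandle (Alex \<phi>)"
proof -
  have b: "bij \<phi>" and a: "Modules.additive \<phi>"
    using assms by (auto simp: Aut_def)
  have "Alex \<phi> x = (\<lambda>c. c + x) \<circ> \<phi> \<circ> (\<lambda>c. c - x)" for x
    by (auto simp: Alex_def)
  moreover have "bij (\<lambda>c. c + x)" "bij (\<lambda>c. c - x)" for x :: 'a
    by (rule bij_betw_byWitness[where f' = "\<lambda>c. c - x"]; simp)
       (rule bij_betw_byWitness[where f' = "\<lambda>c. c + x"]; simp)
  ultimately have "bij (Alex \<phi> x)" for x
    using b by (simp add: bij_comp)
  then show ?thesis
    by (auto simp: quandle_def Alex_def fun_eq_iff algebra_simps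
        additive.add[OF a] additive.diff[OF a] additive.zero[OF a])
qed

end

theory Submission imports Defs begin

text \<open>
  The permutation attached to \<open>a\<close> is the affine map \<open>b \<mapsto> \<phi> b + (a - \<phi> a)\<close>, with
  linear part \<open>\<phi>\<close> whatever \<open>a\<close> is. Its square is \<open>b \<mapsto> \<phi>\<^sup>2 b + (a - \<phi>\<^sup>2 a)\<close>, so \<open>Alex \<phi>\<close> is a
  kei exactly when \<open>\<phi>\<^sup>2 = id\<close>. A good involution \<open>\<rho>\<close> makes the inverse of the map attached to \<open>a\<close>,
  whose linear part is the inverse of \<open>\<phi>\<close>, equal to the map attached to \<open>\<rho> a\<close>, whose linear part
  is \<open>\<phi>\<close>; hence a good involution exists only if \<open>\<phi>\<^sup>2 = id\<close>.

  In a kei the condition on the map attached to \<open>\<rho> a\<close> says that \<open>\<rho> a\<close> and \<open>a\<close> have the same image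
  under \<open>1 - \<phi>\<close>. As \<open>1 - \<phi>\<close> sends \<open>- \<phi> a\<close> to the same element, this means that \<open>\<rho> a\<close>
  differs from \<open>- \<phi> a\<close> by an element \<open>\<psi> a\<close> of \<open>Fix \<phi>\<close>, the kernel of \<open>1 - \<phi>\<close>. In terms
  of \<open>\<psi>\<close>, the condition that \<open>\<rho>\<close> commutes with the permutations becomes invariance of \<open>\<psi>\<close> under
  them, and \<open>\<rho>\<^sup>2 = id\<close> becomes invariance of \<open>\<psi>\<close> under \<open>\<rho>\<close>. The constant functions \<open>\<psi>\<close> satisfy all
  of this, so \<open>c \<mapsto> (\<lambda>a. c - \<phi> a)\<close> embeds \<open>Fix \<phi>\<close> into the good involutions.
\<close>

lemma Aut_additive: "\<phi> \<in> Aut \<Longrightarrow> Modules.additive \<phi>"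
  by (simp add: Aut_def)

lemma Alex_affine:
  assumes "\<phi> \<in> Aut"
  shows "Alex \<phi> a b = \<phi> b + (a - \<phi> a)"
  by (simp add: Alex_def additive.diff[OF Aut_additive[OF assms]])

lemma kei_Alex_iff:
  assumes "\<phi> \<in> Aut"
  shows "kei (Alex \<phi>) \<longleftrightarrow> (\<forall>b. \<phi> (\<phi> b) = b)"
proof
  interpret additive \<phi> using assms by (rule Aut_additive)
  assume "kei (Alex \<phi>)"
  then have "Alex \<phi> 0 (Alex \<phi> 0 b) = b" for b
    by (simp add: kei_def fun_eq_iff)
  then show "\<forall>b. \<phi> (\<phi> b) = b"
    by (simp add: Alex_affine[OF assms] zero)
next
  interpret additive \<phi> using assms by (rule Aut_additive)
  assume "\<forall>b. \<phi> (\<phi> b) = b"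
  then show "kei (Alex \<phi>)"
    by (simp add: kei_def quandle_Alex[OF assms] fun_eq_iff Alex_affine[OF assms] add diff)
qed

text \<open>
  The composite of the maps attached to \<open>x\<close> and \<open>\<rho> x\<close> is the identity; subtracting its value
  at \<open>0\<close> leaves its linear part \<open>\<phi>\<^sup>2\<close>.
\<close>

lemma kei_if_good_involution:
  assumes "\<phi> \<in> Aut" and "good_involution (Alex \<phi>) \<rho>"
  shows "kei (Alex \<phi>)"
proof -
  interpret additive \<phi> using assms(1) by (rule Aut_additive)
  have "bij (Alex \<phi> 0)"
    using quandle_Alex[OF assms(1)] by (simp add: quandle_def)
  moreover have "Alex \<phi> (\<rho> 0) = inv (Alex \<phi> 0)"
    using assms(2) by (simp add: good_involution_def)
  ultimately have cancel: "Alex \<phi> (\<rho> 0) (Alex \<phi> 0 b) = b" for b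
    by (simp add: bij_is_inj)
  have "\<phi> (\<phi> b) = b" for b
    using cancel[of b] cancel[of 0] by (simp add: Alex_affine[OF assms(1)] zero)
  then show ?thesis
    by (simp add: kei_Alex_iff[OF assms(1)])
qed

text \<open>
  In a kei the permutations are their own inverses, and the one attached to \<open>a\<close> is determined by
  \<open>a - \<phi> a\<close>.
\<close>

lemma good_involution_Alex_iff:
  assumes "\<phi> \<in> Aut" and "kei (Alex \<phi>)"
  shows "good_involution (Alex \<phi>) \<rho> \<longleftrightarrow>
    (\<forall>a. \<rho> (\<rho> a) = a) \<and>
    (\<forall>a b. \<rho> (Alex \<phi> a b) = Alex \<phi> a (\<rho> b)) \<and>
    (\<forall>a. \<rho> a - \<phi> (\<rho> a) = a - \<phi> a)"
proof -
  have "inv (Alex \<phi> a) = Alex \<phi> a" for a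
    using assms(2) by (intro inv_unique_comp) (simp_all add: kei_def)
  moreover have "Alex \<phi> x = Alex \<phi> y \<longleftrightarrow> x - \<phi> x = y - \<phi> y" for x y
    by (simp add: fun_eq_iff Alex_affine[OF assms(1)])
  moreover have "bij \<rho>" if "\<forall>a. \<rho> (\<rho> a) = a"
    using that by (intro involuntory_imp_bij) simp
  ultimately show ?thesis
    by (auto simp: good_involution_def fun_eq_iff)
qed

lemma good_involution_Alex_iff_invariant:
  assumes "\<phi> \<in> Aut" and "kei (Alex \<phi>)"
  shows "good_involution (Alex \<phi>) \<rho> \<longleftrightarrow>
    (\<exists>\<psi> \<in> UNIV \<rightarrow> Fix \<phi>. \<forall>a. \<rho> a = \<psi> a - \<phi> a \<and>
      \<psi> \<circ> Alex \<phi> a = \<psi> \<and> \<psi> = \<psi> \<circ> \<rho>)"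
    (is "?good \<longleftrightarrow> (\<exists>\<psi> \<in> _. ?repr \<psi>)")
proof
  interpret additive \<phi> using assms(1) by (rule Aut_additive)
  have invol: "\<phi> (\<phi> b) = b" for b
    using assms by (simp add: kei_Alex_iff)
  assume ?good
  then have \<rho>\<rho>: "\<rho> (\<rho> a) = a"
    and comm: "\<rho> (Alex \<phi> a b) = Alex \<phi> a (\<rho> b)"
    and same: "\<rho> a - \<phi> (\<rho> a) = a - \<phi> a" for a b
    by (simp_all add: good_involution_Alex_iff[OF assms])
  define \<psi> where "\<psi> a = \<rho> a + \<phi> a" for a
  have \<psi>_fixed: "\<phi> (\<rho> a) + a = \<psi> a" for a
    using same[of a] by (simp add: \<psi>_def algebra_simps)
  have "\<psi> \<in> UNIV \<rightarrow> Fix \<phi>"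
    using \<psi>_fixed by (simp add: Fix_def \<psi>_def add invol)
  moreover have "\<psi> (Alex \<phi> a b) = \<psi> b" for a b
  proof -
    have "\<psi> (Alex \<phi> a b) = Alex \<phi> a (\<rho> b) + \<phi> (Alex \<phi> a b)"
      by (simp add: \<psi>_def comm)
    also have "\<dots> = \<phi> (\<rho> b) + b"
      by (simp add: Alex_affine[OF assms(1)] add diff invol)
    finally show ?thesis
      by (simp add: \<psi>_fixed)
  qed
  moreover have "\<psi> (\<rho> a) = \<psi> a" for a
    using \<psi>_fixed[of a] by (simp add: \<psi>_def \<rho>\<rho> add.commute)
  moreover have "\<rho> a = \<psi> a - \<phi> a" for a
    by (simp add: \<psi>_def)
  ultimately show "\<exists>\<psi> \<in> UNIV \<rightarrow> Fix \<phi>. ?repr \<psi>"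
    by (intro bexI[of _ \<psi>]) (simp_all add: fun_eq_iff)
next
  interpret additive \<phi> using assms(1) by (rule Aut_additive)
  have invol: "\<phi> (\<phi> b) = b" for b
    using assms by (simp add: kei_Alex_iff)
  assume "\<exists>\<psi> \<in> UNIV \<rightarrow> Fix \<phi>. ?repr \<psi>"
  then obtain \<psi> where range: "\<psi> \<in> UNIV \<rightarrow> Fix \<phi>" and repr: "?repr \<psi>"
    by blast
  have fixed: "\<phi> (\<psi> a) = \<psi> a" for a
    using range by (auto simp: Fix_def)
  have \<rho>: "\<rho> a = \<psi> a - \<phi> a"
    and \<psi>_Alex: "\<psi> (Alex \<phi> a b) = \<psi> b"
    and \<psi>_\<rho>: "\<psi> (\<rho> a) = \<psi> a" for a b
    using repr by (blast, metis comp_apply, metis comp_apply)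
  have "\<rho> (\<rho> a) = a" for a
  proof -
    have "\<rho> (\<rho> a) = \<psi> a - \<phi> (\<rho> a)"
      using \<rho>[of "\<rho> a"] by (simp only: \<psi>_\<rho>)
    then show ?thesis
      by (simp add: \<rho> diff fixed invol)
  qed
  moreover have "\<rho> (Alex \<phi> a b) = Alex \<phi> a (\<rho> b)" for a b
  proof -
    have "\<rho> (Alex \<phi> a b) = \<psi> b - \<phi> (Alex \<phi> a b)"
      by (simp add: \<rho> \<psi>_Alex)
    then show ?thesis
      by (simp add: \<rho> Alex_affine[OF assms(1)] add diff fixed invol)
  qed
  moreover have "\<rho> a - \<phi> (\<rho> a) = a - \<phi> a" for a
    by (simp add: \<rho> diff fixed invol)
  ultimately show ?good
    by (simp add: good_involution_Alex_iff[OF assms])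
qed

lemma good_involution_const:
  assumes "\<phi> \<in> Aut" and "kei (Alex \<phi>)" and "c \<in> Fix \<phi>"
  shows "good_involution (Alex \<phi>) (\<lambda>a. c - \<phi> a)"
  unfolding good_involution_Alex_iff_invariant[OF assms(1,2)]
  using assms(3) by (intro bexI[of _ "\<lambda>_. c"]) (simp_all add: fun_eq_iff)

theorem theorem4p2:
  fixes \<phi> :: "'a::ab_group_add \<Rightarrow> 'a"
  assumes "\<phi> \<in> Aut"
  shows "(Good (Alex \<phi>) \<noteq> {} \<longleftrightarrow> kei (Alex \<phi>)) \<and>
    (kei (Alex \<phi>) \<longrightarrow>
      (\<forall>\<rho> :: 'a \<Rightarrow> 'a. \<rho> \<in> Good (Alex \<phi>) \<longleftrightarrow>
        (\<exists>\<psi> \<in> UNIV \<rightarrow> Fix \<phi>. \<forall>a. \<rho> a = \<psi> a - \<phi> a \<and>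
          \<psi> \<circ> Alex \<phi> a = \<psi> \<and> \<psi> = \<psi> \<circ> \<rho>)) \<and>
      Fix \<phi> \<lesssim> Good (Alex \<phi>))"
proof -
  interpret additive \<phi> using assms by (rule Aut_additive)
  have "0 \<in> Fix \<phi>"
    by (simp add: Fix_def zero)
  then have "Good (Alex \<phi>) \<noteq> {} \<longleftrightarrow> kei (Alex \<phi>)"
    using kei_if_good_involution[OF assms] good_involution_const[OF assms]
    by (auto simp: Good_def)
  moreover have "Fix \<phi> \<lesssim> Good (Alex \<phi>)" if "kei (Alex \<phi>)"
    unfolding lepoll_def
  proof (intro exI conjI)
    show "inj_on (\<lambda>c a. c - \<phi> a) (Fix \<phi>)"
      by (auto simp: inj_on_def fun_eq_iff)
    show "(\<lambda>c a. c - \<phi> a) ` Fix \<phi> \<subseteq> Good (Alex \<phi>)"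
      using good_involution_const[OF assms that] by (auto simp: Good_def)
  qed
  ultimately show ?thesis
    using good_involution_Alex_iff_invariant[OF assms] by (simp add: Good_def)
qed

end
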